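(* Define finite words over $\{0,1,2\}$ by $w_1=01$ and, for $i\geq 2$, \[ w_i=w_{i-1}^2\Big(\prod_{j=1}^{i-2}w_{i-1-j}\Big)2 , \] and let $w=\lim_{i\to\infty}w_i$ (each $w_i$ is a prefix of $w_{i+1}$). Let $a_0=1$ and $a_i=|w_i|$ for $i\geq1$. Let $T=\{a_i-1\mid i\geq1\}$, and let $I$ be the set consisting of $1$ together with all positive integers whose $(a_i)$-representation ends in a two-block. Then: (1) for every set $S$ with $T\subseteq S\subseteq I$, the Nim sequence of $S$ is $w$; (2) for every such $S$ and every $i\geq0$, the Nim sequence of $S_i=\{s\in S\mid s<a_i\}$ is $\big(w[0..a_i)\big)^\omega$; (3) in particular, there exists a subtraction set of positive density in the natural numbers (namely $I$) whose Nim sequence is ternary (takes values in $\{0,1,2\}$) and aperiodic (not eventually periodic).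
   Context: Products of words denote concatenation; $u^\omega$ is the infinite concatenation of $u$; words are indexed from $0$ and $w[a..b)$ is the factor of $w$ from position $a$ (inclusive) to $b$ (exclusive). A representing sequence is a strictly increasing sequence $(a_i)_{i\ge0}$ of positive integers with $a_0=1$. For a positive integer $n$ with $a_j\le n<a_{j+1}$, its $(a_i)$-representation is the digit string $d_jd_{j-1}\cdots d_0$ of nonnegative integers with $n=\sum_{i=0}^j d_ia_i$ and $\sum_i d_i$ minimal; it is obtained greedily ($d_j=\lfloor n/a_j\rfloor$, and the remaining digits are the representation of $n \bmod a_j$, padded with zeros). A two-block is a block of consecutive digits of the form $21^m0$ with $m\geq0$; "the representation ends in a two-block" means its final digits form such a block. For a set $S$ of positive integers (a subtraction set), the Sprague–Grundy function is $\mathrm{SG}_S(n)=\mathrm{mex}\{\mathrm{SG}_S(n-s)\mid s\in S,\ s\le n\}$ ($\mathrm{mex}$ = least nonnegative integer not in the set), and the Nim sequence of $S$ is the infinite word $(\mathrm{SG}_S(n))_{n\ge0}$. *)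

theory Defs
  imports Complex_Main "HOL-Library.Sublist"
begin

definition mex :: "nat set \<Rightarrow> nat" where
  "mex A = (LEAST n. n \<notin> A)"

text \<open>The guard \<open>0 < s\<close> only serves termination: subtraction sets consist of positive
  integers. The function itself, as an infinite word, is the Nim sequence of \<open>S\<close>.\<close>

function SG :: "nat set \<Rightarrow> nat \<Rightarrow> nat" where
  "SG S n = mex ((\<lambda>s. SG S (n - s)) ` {s \<in> S. 0 < s \<and> s \<le> n})"
  by auto
termination
  by (relation "measure snd") auto

declare SG.simps [simp del]

text \<open>The finite words \<open>w\<^sub>i\<close>, for \<open>i \<ge> 1\<close>; the value at \<open>0\<close> is a dummy.\<close>

function wd :: "nat \<Rightarrow> nat list" where
  "wd 0 = []"
| "wd (Suc 0) = [0, 1]"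
| "wd (Suc (Suc n)) =
     wd (Suc n) @ wd (Suc n) @ concat (map (\<lambda>j. wd (Suc n - j)) [1..<Suc n]) @ [2]"
  by pat_completeness auto
termination
  by (relation "measure id") auto

lemma prefix_wd_Suc: "prefix (wd i) (wd (Suc i))"
  by (cases i rule: wd.cases) auto

text \<open>The letterwise limit of the \<open>w\<^sub>i\<close>, in the discrete topology on \<^typ>\<open>nat\<close>.\<close>

definition lim_word :: "nat \<Rightarrow> nat" where
  "lim_word n = lim (\<lambda>i. wd i ! n)"

lemma prefix_wd_mono: "i \<le> j \<Longrightarrow> prefix (wd i) (wd j)"
  by (induction j rule: dec_induct) (auto intro: prefix_order.trans prefix_wd_Suc)

lemma lim_word_eq_nth: "n < length (wd i) \<Longrightarrow> lim_word n = wd i ! n"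
proof -
  assume n: "n < length (wd i)"
  have "eventually (\<lambda>k. wd k ! n = wd i ! n) sequentially"
    using eventually_ge_at_top[of i]
  proof eventually_elim
    case (elim k)
    then show ?case
      using prefix_wd_mono[OF elim] n by (auto simp: prefix_def nth_append)
  qed
  then have "(\<lambda>k. wd k ! n) \<longlonglongrightarrow> wd i ! n"
    by (rule tendsto_eventually)
  then show ?thesis
    unfolding lim_word_def by (rule limI)
qed

text \<open>The representing sequence \<open>a\<^sub>0 = 1\<close>, \<open>a\<^sub>i = |w\<^sub>i|\<close>.\<close>

definition wlen :: "nat \<Rightarrow> nat" where
  "wlen i = (if i = 0 then 1 else length (wd i))"

text \<open>Digit strings are lists \<open>[d\<^sub>j, \<dots>, d\<^sub>0]\<close>, most significant digit first.\<close>

definition digit_value :: "(nat \<Rightarrow> nat) \<Rightarrow> nat list \<Rightarrow> nat" where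
  "digit_value b ds = (\<Sum>i<length ds. rev ds ! i * b i)"

definition is_representation :: "(nat \<Rightarrow> nat) \<Rightarrow> nat \<Rightarrow> nat list \<Rightarrow> bool" where
  "is_representation b n ds \<longleftrightarrow>
     (\<exists>j. b j \<le> n \<and> n < b (Suc j) \<and> length ds = Suc j \<and> digit_value b ds = n \<and>
          (\<forall>es. length es = Suc j \<and> digit_value b es = n \<longrightarrow> sum_list ds \<le> sum_list es))"

definition ends_in_two_block :: "nat list \<Rightarrow> bool" where
  "ends_in_two_block ds \<longleftrightarrow> (\<exists>m. suffix (2 # replicate m 1 @ [0]) ds)"

definition T_set :: "nat set" where
  "T_set = {wlen i - 1 | i. i \<ge> 1}"

text \<open>For the sequence \<open>wlen\<close> the representation is unique and coincides with the greedy
  one, so the existential quantifier over \<open>ds\<close> is harmless.\<close>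

definition I_set :: "nat set" where
  "I_set = {1} \<union> {n. 0 < n \<and> (\<exists>ds. is_representation wlen n ds \<and> ends_in_two_block ds)}"

definition factor :: "(nat \<Rightarrow> 'c) \<Rightarrow> nat \<Rightarrow> nat \<Rightarrow> 'c list" where
  "factor x l r = map x [l..<r]"

definition omega_power :: "'c list \<Rightarrow> nat \<Rightarrow> 'c" where
  "omega_power u n = u ! (n mod length u)"

definition eventually_periodic :: "(nat \<Rightarrow> 'c) \<Rightarrow> bool" where
  "eventually_periodic x \<longleftrightarrow> (\<exists>p>0. \<exists>N. \<forall>n\<ge>N. x (n + p) = x n)"

definition has_natural_density :: "nat set \<Rightarrow> real \<Rightarrow> bool" where
  "has_natural_density A d \<longleftrightarrow>
     (\<lambda>N. real (card (A \<inter> {1..N})) / real N) \<longlonglongrightarrow> d"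

end

theory Submission
  imports Defs
begin

text \<open>
  The lengths satisfy \<open>a\<^sub>i\<^sub>+\<^sub>1 = 3 a\<^sub>i - a\<^sub>i\<^sub>-\<^sub>1\<close> and \<open>a\<^sub>i\<^sub>-\<^sub>1 a\<^sub>i\<^sub>+\<^sub>1 = a\<^sub>i\<^sup>2 + 1\<close>,
  and \<open>w\<^sub>i\<close> codes the rotation by \<open>p = a\<^sub>i\<^sub>-\<^sub>1\<close> on the integers modulo \<open>q = a\<^sub>i\<close>: its \<open>n\<close>-th letter is
  \<open>0\<close>, \<open>1\<close> or \<open>2\<close> according to which of the intervals \<open>(0, p]\<close>, \<open>(p, 2p]\<close>, \<open>(2p, q]\<close> contains
  the residue of \<open>(n + 1) p\<close>. A minimal digit string is greedy, and for greedy strings the representation of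
  \<open>n\<close> ends in a two-block iff the \<open>n\<close>-th letter of \<open>w\<close> is \<open>2\<close>. Hence subtracting an element of
  \<open>I\<close> rotates by an amount in \<open>[p, q - p]\<close>, which always changes the letter because no interval is
  longer than \<open>p\<close>; the smaller letters are reached by subtracting \<open>1\<close>, or \<open>a\<^sub>k - 1\<close> where \<open>w\<^sub>k\<close> is
  the block closed by the letter \<open>2\<close> in question. Counting returns to \<open>(2p, q]\<close> telescopes, so the number of letters
  \<open>2\<close> among the first \<open>n\<close> is \<open>n (\<surd>5 - 2)\<close> up to a bounded error; the irrationality of this
  frequency excludes eventual periodicity.
\<close>

section \<open>Lengths of the words\<close>

text \<open>The product \<open>w\<^sub>n ... w\<^sub>1 2\<close> that closes
  \<open>wd (Suc (Suc n))\<close>. For \<open>n > 0\<close> it is also what follows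
  \<open>wd n\<close> in \<open>wd (Suc n)\<close>, so the last piece of a word is a suffix of the
  preceding word.\<close>

fun wd_tail :: "nat \<Rightarrow> nat list" where
  "wd_tail 0 = [2]"
| "wd_tail (Suc n) = wd (Suc n) @ wd_tail n"

lemma concat_wd_eq_wd_tail:
  "concat (map (\<lambda>j. wd (Suc n - j)) [1..<Suc n]) @ [2] = wd_tail n"
proof (induction n)
  case (Suc n)
  have "map (\<lambda>j. wd (Suc (Suc n) - j)) [1..<Suc (Suc n)]
      = wd (Suc n) # map (\<lambda>j. wd (Suc (Suc n) - j)) [Suc 1..<Suc (Suc n)]"
    by (subst upt_conv_Cons) auto
  also have "map (\<lambda>j. wd (Suc (Suc n) - j)) [Suc 1..<Suc (Suc n)]
      = map (\<lambda>j. wd (Suc n - j)) [1..<Suc n]"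
    unfolding map_Suc_upt[symmetric] by (simp add: o_def del: upt_Suc)
  finally show ?case
    using Suc by (simp del: upt_Suc)
qed simp

lemma wd_Suc_Suc: "wd (Suc (Suc n)) = wd (Suc n) @ wd (Suc n) @ wd_tail n"
  by (simp only: wd.simps concat_wd_eq_wd_tail)

declare wd.simps(3) [simp del]

lemma wd_conv_wd_tail: "wd (Suc (Suc n)) = wd (Suc n) @ wd_tail (Suc n)"
  by (simp add: wd_Suc_Suc)

lemma wlen_0 [simp]: "wlen 0 = 1" and wlen_1 [simp]: "wlen (Suc 0) = 2"
  by (simp_all add: wlen_def)

lemma length_wd [simp]: "length (wd (Suc n)) = wlen (Suc n)"
  by (simp add: wlen_def)

lemma length_wd_tail: "length (wd_tail n) + wlen n = wlen (Suc n)"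
proof (induction n)
  case (Suc n)
  then show ?case
    using arg_cong[OF wd_Suc_Suc[of n], of length] by simp
qed simp

lemma wlen_rec: "wlen (Suc (Suc n)) + wlen n = 3 * wlen (Suc n)"
  using arg_cong[OF wd_Suc_Suc[of n], of length] length_wd_tail[of n] by simp

lemma wd_tail_nonempty: "wd_tail n \<noteq> []"
  by (induction n) auto

lemma wlen_less_Suc: "wlen n < wlen (Suc n)"
  using length_wd_tail[of n] wd_tail_nonempty[of n] by (cases "wd_tail n") auto

lemma wlen_pos [simp]: "0 < wlen n"
proof (cases n)
  case (Suc m)
  then show ?thesis using wlen_less_Suc[of m] by simp
qed simp

lemma less_wlen: "n < wlen n"
proof (induction n)
  case (Suc n)
  then show ?case using wlen_less_Suc[of n] by linarith
qed simp

text \<open>The recurrence leaves \<open>a * c - b\<^sup>2\<close> invariant along consecutive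
  lengths, and 1, 2, 5 start it at 1.\<close>

lemma wlen_cassini: "wlen n * wlen (Suc (Suc n)) = (wlen (Suc n))\<^sup>2 + 1"
proof (induction n)
  case 0
  show ?case using wlen_rec[of 0] by simp
next
  case (Suc n)
  define a b c d where "a = int (wlen n)" and "b = int (wlen (Suc n))"
    and "c = int (wlen (Suc (Suc n)))" and "d = int (wlen (Suc (Suc (Suc n))))"
  have "a * c = b\<^sup>2 + 1"
    using arg_cong[OF Suc, of int] by (simp add: a_def b_def c_def)
  moreover have "c + a = 3 * b" "d + b = 3 * c"
    using arg_cong[OF wlen_rec[of n], of int] arg_cong[OF wlen_rec[of "Suc n"], of int]
    by (simp_all add: a_def b_def c_def d_def)
  ultimately have "b * d = c\<^sup>2 + 1" by algebra
  then have "int (wlen (Suc n) * wlen (Suc (Suc (Suc n)))) = int ((wlen (Suc (Suc n)))\<^sup>2 + 1)"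
    by (simp add: b_def c_def d_def)
  then show ?case by (simp only: of_nat_eq_iff)
qed

lemma lim_word_eq_wd: "n < wlen (Suc i) \<Longrightarrow> lim_word n = wd (Suc i) ! n"
  by (rule lim_word_eq_nth) simp

section \<open>Coding the words by rotations\<close>

text \<open>Subtracting 1 before the reduction makes \<open>z + 1\<close> the representative of
  \<open>(n + 1) * p\<close> in \<open>1..q\<close>, so a vanishing residue counts as
  \<open>q\<close>.\<close>

definition rot_code :: "int \<Rightarrow> int \<Rightarrow> int \<Rightarrow> nat" where
  "rot_code p q n =
     (let z = ((n + 1) * p - 1) mod q in if z < p then 0 else if z < 2 * p then 1 else 2)"

lemma rot_code_eqI:
  assumes "(n + 1) * p = k * q + y" "1 \<le> y" "y \<le> q"
  shows "rot_code p q n = (if y \<le> p then 0 else if y \<le> 2 * p then 1 else 2)"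
proof -
  have "((n + 1) * p - 1) mod q = (y - 1 + k * q) mod q"
    unfolding assms(1) by (simp add: algebra_simps)
  also have "\<dots> = y - 1"
    using assms by simp
  finally show ?thesis
    unfolding rot_code_def by simp
qed

lemma rot_code_periodic: "rot_code p q (n + q * k) = rot_code p q n"
proof -
  have "(n + q * k + 1) * p - 1 = (n + 1) * p - 1 + q * (k * p)"
    by (simp add: algebra_simps)
  then show ?thesis
    unfolding rot_code_def by (simp only: mod_mult_self2)
qed

lemma rot_code_mod: "rot_code p q (n mod q) = rot_code p q n"
  using rot_code_periodic[of p q "n mod q" "n div q"] by simp

lemma rot_code_cases:
  assumes "q > 0"
  obtains k y where "(n + 1) * p = k * q + y" "1 \<le> y" "y \<le> q"
    "rot_code p q n = (if y \<le> p then 0 else if y \<le> 2 * p then 1 else 2)"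
proof -
  define x where "x = (n + 1) * p - 1"
  have "(n + 1) * p = (x div q) * q + (x mod q + 1)"
    using div_mult_mod_eq[of x q] by (simp add: x_def)
  moreover have "1 \<le> x mod q + 1" "x mod q + 1 \<le> q"
    using assms by (simp_all add: zless_imp_add1_zle)
  ultimately show ?thesis
    using that rot_code_eqI by blast
qed

text \<open>With the same winding number \<open>k\<close>, the residues \<open>x\<close> modulo
  \<open>b\<close> and \<open>y\<close> modulo \<open>c\<close> satisfy
  \<open>b * y = c * x - (n + 1)\<close>. Since \<open>a * c = b\<^sup>2 + 1\<close>, the endpoint
  \<open>j * a\<close> corresponds to \<open>j * b\<close> up to an error too small to change the
  letter. The shifts 0, \<open>b\<close> and \<open>c - b\<close> belong to the three pieces of the
  next word.\<close>

lemma rot_code_refine: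
  fixes a b c n :: int
  assumes "0 < a" "a < b" "c + a = 3 * b" "a * c = b\<^sup>2 + 1" "0 \<le> n" "n < b"
  shows "rot_code b c n = rot_code a b n"
    and "rot_code b c (n + b) = rot_code a b n"
    and "2 \<le> n \<Longrightarrow> rot_code b c (n + (c - b)) = rot_code a b n"
proof -
  from assms have "b > 0" by simp
  then obtain k x where x: "(n + 1) * a = k * b + x" "1 \<le> x" "x \<le> b"
    and code: "rot_code a b n = (if x \<le> a then 0 else if x \<le> 2 * a then 1 else 2)"
    by (rule rot_code_cases)
  \<comment> \<open>\<open>b\<^sup>2 \<equiv> -1\<close> modulo \<open>c\<close>, so a shift by \<open>b\<close> moves \<open>y\<close> by \<open>-1\<close>, a shift by \<open>c - b\<close> by \<open>+1\<close>.\<close>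
  define y where "y = (n + 1) * b - k * c"
  have y: "b * y = c * x - (n + 1)"
    using x(1) assms(3,4) unfolding y_def by algebra
  have c: "2 * b < c" using assms by simp
  have lower: "b * (j * b + 1) < b * y" if "j * a + 1 \<le> x" "0 \<le> j" for j
  proof -
    have "c * (j * a + 1) \<le> c * x" using that c assms by (intro mult_left_mono) auto
    moreover have "c * (j * a + 1) = j * (b\<^sup>2 + 1) + c"
      unfolding assms(4)[symmetric] by (simp add: algebra_simps)
    ultimately show ?thesis using y that c assms by (simp add: algebra_simps power2_eq_square)
  qed
  have upper: "b * y \<le> b * (j * b) + j - (n + 1)" if "x \<le> j * a" for j
  proof -
    have "c * x \<le> c * (j * a)" using that c assms by (intro mult_left_mono) auto
    moreover have "c * (j * a) = j * (b\<^sup>2 + 1)"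
      unfolding assms(4)[symmetric] by (simp add: algebra_simps)
    ultimately show ?thesis using y by (simp add: algebra_simps power2_eq_square)
  qed
  have top: "b * y \<le> b * c - (n + 1)"
  proof -
    have "c * x \<le> c * b" using x c assms by (intro mult_left_mono) auto
    then show ?thesis using y by (simp add: algebra_simps)
  qed
  \<comment> \<open>A residue above a lower endpoint is at least 2 above it, which leaves room for
    the shift by -1.\<close>
  have lower': "j * b + 2 \<le> y" if "j * a + 1 \<le> x" "0 \<le> j" for j
    using lower[OF that] \<open>b > 0\<close> by simp
  have upper': "y \<le> j * b" if "x \<le> j * a" "j \<le> 2" for j
  proof -
    have "b * y < b * (j * b + 1)" using upper[OF that(1)] that assms by (simp add: algebra_simps)
    then show ?thesis using \<open>b > 0\<close> by simp
  qed
  \<comment> \<open>From \<open>n = 2\<close> on the upper endpoint is missed too, which leaves room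
    for the shift by +1.\<close>
  have upper'': "y < j * b" if "x \<le> j * a" "j \<le> 2" "2 \<le> n" for j
  proof -
    have "b * y < b * (j * b)" using upper[OF that(1)] that assms by linarith
    then show ?thesis using \<open>b > 0\<close> by simp
  qed
  have y_less: "y < c"
  proof -
    have "b * y < b * c" using top assms by linarith
    then show ?thesis using \<open>b > 0\<close> by simp
  qed
  have "2 \<le> y" using lower'[of 0] x by simp
  have bands: "x \<le> a \<and> y \<le> b \<or> a < x \<and> x \<le> 2 * a \<and> b + 2 \<le> y \<and> y \<le> 2 * b
      \<or> 2 * a < x \<and> 2 * b + 2 \<le> y"
  proof -
    consider "x \<le> a" | "a < x" "x \<le> 2 * a" | "2 * a < x" by linarith
    then show ?thesis
    proof cases
      case 1 then show ?thesis using upper'[of 1] by simp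
    next
      case 2 then show ?thesis using lower'[of 1] upper'[of 2] by simp
    next
      case 3 then show ?thesis using lower'[of 2] by simp
    qed
  qed
  have bands': "x \<le> a \<and> y < b \<or> a < x \<and> x \<le> 2 * a \<and> b + 2 \<le> y \<and> y < 2 * b
      \<or> 2 * a < x \<and> 2 * b + 2 \<le> y" if "2 \<le> n"
    using bands upper''[of 1] upper''[of 2] that by auto
  have "rot_code b c n = (if y \<le> b then 0 else if y \<le> 2 * b then 1 else 2)"
    using \<open>2 \<le> y\<close> y_less by (intro rot_code_eqI[where k = k]) (auto simp: y_def)
  then show "rot_code b c n = rot_code a b n"
    unfolding code using bands \<open>0 < a\<close> \<open>b > 0\<close> by auto
  have "rot_code b c (n + b) = (if y - 1 \<le> b then 0 else if y - 1 \<le> 2 * b then 1 else 2)"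
    using \<open>2 \<le> y\<close> y_less
  proof (intro rot_code_eqI[where k = "k + a"])
    show "(n + b + 1) * b = (k + a) * c + (y - 1)"
      using assms(4) unfolding y_def by algebra
  qed auto
  then show "rot_code b c (n + b) = rot_code a b n"
    unfolding code using bands \<open>0 < a\<close> \<open>b > 0\<close> by auto
  assume "2 \<le> n"
  have "rot_code b c (n + (c - b)) = (if y + 1 \<le> b then 0 else if y + 1 \<le> 2 * b then 1 else 2)"
    using \<open>2 \<le> y\<close> y_less
  proof (intro rot_code_eqI[where k = "k + b - a"])
    show "(n + (c - b) + 1) * b = (k + b - a) * c + (y + 1)"
      using assms(4) unfolding y_def by algebra
  qed auto
  then show "rot_code b c (n + (c - b)) = rot_code a b n"
    unfolding code using bands'[OF \<open>2 \<le> n\<close>] \<open>0 < a\<close> \<open>b > 0\<close> by auto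
qed

text \<open>Induction along \<open>wd (Suc (Suc i)) = wd (Suc i) @ wd (Suc i) @ wd_tail i\<close>,
  with one equation of \<open>rot_code_refine\<close> for each piece.\<close>

lemma wd_eq_rot_code:
  "n < wlen (Suc i) \<Longrightarrow> wd (Suc i) ! n = rot_code (wlen i) (wlen (Suc i)) n"
proof (induction i arbitrary: n)
  case 0
  then have "n = 0 \<or> n = 1" by auto
  then show ?case by (auto simp: rot_code_def)
next
  case (Suc i)
  define a b c where "a = int (wlen i)" and "b = int (wlen (Suc i))"
    and "c = int (wlen (Suc (Suc i)))"
  have abc: "0 < a" "a < b" "c + a = 3 * b" "a * c = b\<^sup>2 + 1"
    using arg_cong[OF wlen_rec[of i], of int] arg_cong[OF wlen_cassini[of i], of int]
      wlen_less_Suc[of i] by (simp_all add: a_def b_def c_def)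
  note ref = rot_code_refine[OF abc]
  consider "n < wlen (Suc i)" | "wlen (Suc i) \<le> n" "n < 2 * wlen (Suc i)"
    | "2 * wlen (Suc i) \<le> n" by linarith
  then show ?case
  proof cases
    case 1
    then have "wd (Suc (Suc i)) ! n = wd (Suc i) ! n"
      by (simp add: wd_Suc_Suc nth_append)
    also have "\<dots> = rot_code a b n" using Suc.IH[OF 1] by (simp add: a_def b_def)
    also have "\<dots> = rot_code b c n" using ref(1)[of n] 1 by (simp add: b_def)
    finally show ?thesis by (simp add: b_def c_def)
  next
    case 2
    define m where "m = n - wlen (Suc i)"
    have m: "m < wlen (Suc i)" "int n = int m + b" using 2 by (auto simp: m_def b_def)
    have "wd (Suc (Suc i)) ! n = wd (Suc i) ! m"
      using 2 m(1) by (simp add: wd_Suc_Suc nth_append m_def)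
    also have "\<dots> = rot_code a b m" using Suc.IH[OF m(1)] by (simp add: a_def b_def)
    also have "\<dots> = rot_code b c n" using ref(2)[of m] m by (simp add: b_def)
    finally show ?thesis by (simp add: b_def c_def)
  next
    case 3
    show ?thesis
    proof (cases i)
      case 0
      \<comment> \<open>\<open>wd_tail 0 = [2]\<close> is not a suffix of \<open>[0, 1]\<close>, so
        this letter is computed directly.\<close>
      have "wlen (Suc (Suc 0)) = 5" using wlen_rec[of 0] by simp
      moreover from this have "n = 4" using 3 Suc.prems 0 by simp
      ultimately show ?thesis using 0
        by (simp add: wd_Suc_Suc rot_code_def)
    next
      case (Suc i')
      define r where "r = n - 2 * wlen (Suc i)"
      \<comment> \<open>\<open>wd (Suc i)\<close> is \<open>wd i\<close> followed by
        \<open>wd_tail i\<close>, so \<open>m\<close> is the place of letter \<open>r\<close> of the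
        tail there. The distance from \<open>m\<close> to \<open>n\<close> is
        \<open>2 * b - a = c - b\<close>.\<close>
      define m where "m = wlen i + r"
      have r: "r < length (wd_tail i)"
        using 3 Suc.prems length_wd_tail[of i] wlen_rec[of i] by (simp add: r_def)
      have m: "m < wlen (Suc i)" "int n = int m + (c - b)"
        using r length_wd_tail[of i] 3 abc by (auto simp: m_def r_def a_def b_def)
      have "2 \<le> m"
        using wlen_less_Suc[of i'] wlen_pos[of i'] unfolding m_def Suc by linarith
      have "wd (Suc (Suc i)) ! n = wd_tail i ! r"
      proof -
        have "\<not> n < wlen (Suc i)" "\<not> n - wlen (Suc i) < wlen (Suc i)" using 3 by auto
        then show ?thesis by (simp add: wd_Suc_Suc nth_append r_def mult_2)
      qed
      also have "\<dots> = wd (Suc i) ! m"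
        unfolding Suc wd_conv_wd_tail by (simp add: nth_append m_def Suc)
      also have "\<dots> = rot_code a b m" using Suc.IH[OF m(1)] by (simp add: a_def b_def)
      also have "\<dots> = rot_code b c n" using ref(3)[of m] m \<open>2 \<le> m\<close> by (simp add: b_def)
      finally show ?thesis by (simp add: b_def c_def)
    qed
  qed
qed


section \<open>Minimal digit strings and two-blocks\<close>

lemma digit_value_Nil [simp]: "digit_value b [] = 0"
  by (simp add: digit_value_def)

lemma digit_value_Cons [simp]:
  "digit_value b (d # ds) = d * b (length ds) + digit_value b ds"
  by (simp add: digit_value_def nth_append)

text \<open>Carrying strictly decreases the digit sum: \<open>3 a\<^sub>i = a\<^sub>i\<^sub>+\<^sub>1 + a\<^sub>i\<^sub>-\<^sub>1\<close>, and a leading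
  digit \<open>2\<close> is removed by carrying into the next digit, since \<open>a\<^sub>i\<^sub>+\<^sub>1 - 2 a\<^sub>i = a\<^sub>i - a\<^sub>i\<^sub>-\<^sub>1\<close>.\<close>

lemma digit_reduction:
  assumes "wlen (length ds) \<le> digit_value wlen ds"
  shows "\<exists>es. length es = length ds \<and> sum_list es + 2 \<le> sum_list ds \<and>
    digit_value wlen es + wlen (length ds) = digit_value wlen ds"
  using assms
proof (induction "length ds + sum_list ds" arbitrary: ds rule: less_induct)
  case less
  consider "ds = []" | d where "ds = [d]" | d e es where "ds = d # e # es"
    by (metis list.exhaust)
  then show ?case
  proof cases
    case 1
    then show ?thesis using less.prems by simp
  next
    case (2 d)
    then show ?thesis using less.prems by (intro exI[of _ "[d - 2]"]) auto
  next
    case (3 d e es)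
    let ?a = "wlen (length es)" and ?b = "wlen (Suc (length es))"
      and ?c = "wlen (Suc (Suc (length es)))"
    have ab: "?c + ?a = 3 * ?b" "?a < ?b" by (rule wlen_rec, rule wlen_less_Suc)
    consider "d \<le> 1" | "d = 2" | d' where "d = d' + 3"
      by (metis add.commute le_Suc_ex not_less_eq_eq numeral_2_eq_2 numeral_3_eq_3
          le_antisym One_nat_def)
    then show ?thesis
    proof cases
      case 1
      \<comment> \<open>The lower digits alone reach the place value of \<open>d\<close>. Reducing
        them saves at least 2 and the carry into \<open>d\<close> costs 1, so the new string has the
        same value and a smaller digit sum, and the induction hypothesis applies once more.\<close>
      have "d * ?b \<le> ?b" using 1 by (cases d) auto
      then have "?b \<le> digit_value wlen (e # es)"
        using less.prems ab unfolding 3 digit_value_Cons length_Cons by linarith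
      then obtain fs where fs: "length fs = Suc (length es)" "sum_list fs + 2 \<le> sum_list (e # es)"
        "digit_value wlen fs + ?b = digit_value wlen (e # es)"
        using less.hyps[of "e # es"] by (auto simp: 3)
      have val: "digit_value wlen (Suc d # fs) = digit_value wlen ds"
        using fs by (simp add: 3)
      have "length (Suc d # fs) + sum_list (Suc d # fs) < length ds + sum_list ds"
        using fs by (simp add: 3)
      moreover have "wlen (length (Suc d # fs)) \<le> digit_value wlen (Suc d # fs)"
        unfolding val using less.prems fs by (simp add: 3)
      ultimately obtain gs where "length gs = length (Suc d # fs)"
        "sum_list gs + 2 \<le> sum_list (Suc d # fs)"
        "digit_value wlen gs + wlen (length (Suc d # fs)) = digit_value wlen (Suc d # fs)"
        using less.hyps by blast
      then show ?thesis
        unfolding val using fs by (intro exI[of _ gs]) (simp add: 3)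
    next
      case 2
      have "wlen (length (Suc e # es)) \<le> digit_value wlen (Suc e # es)"
        using less.prems ab by (simp add: 3 2)
      then obtain gs where "length gs = Suc (length es)" "sum_list gs + 2 \<le> sum_list (Suc e # es)"
        "digit_value wlen gs + ?b = digit_value wlen (Suc e # es)"
        using less.hyps[of "Suc e # es"] by (auto simp: 3 2)
      then show ?thesis using ab by (intro exI[of _ "0 # gs"]) (simp add: 3 2)
    next
      case (3 d')
      then show ?thesis using ab
        by (intro exI[of _ "d' # Suc e # es"]) (simp add: \<open>ds = d # e # es\<close> algebra_simps)
    qed
  qed
qed

text \<open>Bounding every suffix by the next length makes each digit the quotient that the greedy
  algorithm takes.\<close>

fun greedy :: "nat list \<Rightarrow> bool" where
  "greedy [] \<longleftrightarrow> True"
| "greedy (d # ds) \<longleftrightarrow> digit_value wlen (d # ds) < wlen (Suc (length ds)) \<and> greedy ds"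

text \<open>If the digits below \<open>d\<close> reached its place value,
  \<open>digit_reduction\<close> would save at least 2 while the carry costs 1, against minimality.
  Minimality passes to the lower digits, so the induction continues.\<close>

lemma greedy_if_minimal:
  assumes "digit_value wlen ds < wlen (length ds)"
    and "\<And>es. length es = length ds \<Longrightarrow> digit_value wlen es = digit_value wlen ds \<Longrightarrow>
      sum_list ds \<le> sum_list es"
  shows "greedy ds"
  using assms
proof (induction ds)
  case (Cons d ds)
  have "digit_value wlen ds < wlen (length ds)"
  proof (rule ccontr)
    assume "\<not> ?thesis"
    then obtain es where "length es = length ds" "sum_list es + 2 \<le> sum_list ds"
      "digit_value wlen es + wlen (length ds) = digit_value wlen ds"
      using digit_reduction[of ds] by auto
    then show False
      using Cons.prems(2)[of "Suc d # es"] by simp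
  qed
  moreover have "sum_list ds \<le> sum_list es"
    if "length es = length ds" "digit_value wlen es = digit_value wlen ds" for es
    using Cons.prems(2)[of "d # es"] that by simp
  ultimately show ?case
    using Cons by simp
qed simp

text \<open>What has to follow a digit 2 for a two-block to end the string.\<close>

definition closes_two_block :: "nat list \<Rightarrow> bool" where
  "closes_two_block ds \<longleftrightarrow> (\<exists>m. ds = replicate m 1 @ [0])"

lemma closes_two_block_Cons:
  "closes_two_block (d # ds) \<longleftrightarrow> d = 0 \<and> ds = [] \<or> d = 1 \<and> closes_two_block ds"
proof -
  have "closes_two_block (d # ds) \<longleftrightarrow>
      d # ds = replicate 0 1 @ [0] \<or> (\<exists>m. d # ds = replicate (Suc m) 1 @ [0])"
    unfolding closes_two_block_def by (metis not0_implies_Suc)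
  then show ?thesis
    by (auto simp: closes_two_block_def)
qed

lemma ends_in_two_block_Nil: "\<not> ends_in_two_block []"
  by (simp add: ends_in_two_block_def)

lemma ends_in_two_block_Cons:
  "ends_in_two_block (d # ds) \<longleftrightarrow> d = 2 \<and> closes_two_block ds \<or> ends_in_two_block ds"
  unfolding ends_in_two_block_def closes_two_block_def by (auto simp: suffix_Cons)

text \<open>The leading digit names the piece of the word that contains the position: 0 and 1 for
  the two copies, 2 for the tail. Inside a tail, 0 stays in its first word and 1 moves on to the
  shorter tail, so the closing 2 sits at digits \<open>1...10\<close>. The two claims therefore run
  through one induction.\<close>

lemma greedy_nth_wd:
  assumes "greedy ds" "length ds = Suc l"
  shows "wd (Suc l) ! digit_value wlen ds = 2 \<longleftrightarrow> ends_in_two_block ds"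
    and "digit_value wlen ds < length (wd_tail l) \<Longrightarrow>
      wd_tail l ! digit_value wlen ds = 2 \<longleftrightarrow> closes_two_block ds \<or> ends_in_two_block ds"
  using assms
proof (induction l arbitrary: ds)
  case 0
  case 1
  then obtain d where "ds = [d]" "d < 2" by (auto simp: length_Suc_conv)
  then show ?case
    by (auto simp: ends_in_two_block_Cons ends_in_two_block_Nil closes_two_block_def less_2_cases_iff)
next
  case 0
  case 2
  then show ?case
    by (auto simp: length_Suc_conv ends_in_two_block_Nil closes_two_block_Cons)
next
  case (Suc l)
  case 1
  then obtain d es where ds: "ds = d # es" and es: "greedy es" "length es = Suc l"
    by (auto simp: length_Suc_conv)
  let ?b = "wlen (Suc l)" and ?v = "digit_value wlen es"
  have v: "?v < ?b" using es by (cases es) auto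
  have total: "d * ?b + ?v < wlen (Suc (Suc l))" using 1 ds es by simp
  have ab: "wlen (Suc (Suc l)) + wlen l = 3 * ?b" "length (wd_tail l) + wlen l = ?b"
    by (rule wlen_rec, rule length_wd_tail)
  have "d < 3"
  proof (rule ccontr)
    assume "\<not> d < 3"
    then have "3 * ?b \<le> d * ?b" by simp
    then show False using total ab by linarith
  qed
  then consider "d = 0" | "d = 1" | "d = 2" by linarith
  then show ?case
  proof cases
    case 3
    then have "?v < length (wd_tail l)" using total ab by simp
    with 3 es show ?thesis
      using Suc.IH(2)[of es]
      by (simp add: ds wd_Suc_Suc nth_append mult_2 ends_in_two_block_Cons)
  qed (use es v Suc.IH(1)[of es] in \<open>auto simp: ds wd_Suc_Suc nth_append ends_in_two_block_Cons\<close>)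
next
  case (Suc l)
  case 2
  then obtain d es where ds: "ds = d # es" and es: "greedy es" "length es = Suc l"
    by (auto simp: length_Suc_conv)
  let ?b = "wlen (Suc l)" and ?v = "digit_value wlen es"
  have v: "?v < ?b" using es by (cases es) auto
  have total: "d * ?b + ?v < ?b + length (wd_tail l)" using 2 ds es by simp
  have ab: "length (wd_tail l) + wlen l = ?b" by (rule length_wd_tail)
  have "d < 2"
  proof (rule ccontr)
    assume "\<not> d < 2"
    then have "2 * ?b \<le> d * ?b" by simp
    then show False using total ab by linarith
  qed
  then consider "d = 0" | "d = 1" by linarith
  then show ?case
    by cases (use es v total Suc.IH[of es] in
      \<open>auto simp: ds nth_append ends_in_two_block_Cons closes_two_block_Cons\<close>)
qed

lemma lim_word_0 [simp]: "lim_word 0 = 0" and lim_word_1 [simp]: "lim_word (Suc 0) = 1"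
  by (simp_all add: lim_word_eq_wd[where i = 0])

lemma lim_word_eq_2_iff_ends_in_two_block:
  assumes "is_representation wlen n ds"
  shows "lim_word n = 2 \<longleftrightarrow> ends_in_two_block ds"
proof -
  obtain j where j: "n < wlen (Suc j)" "length ds = Suc j" "digit_value wlen ds = n"
    "\<And>es. length es = Suc j \<Longrightarrow> digit_value wlen es = n \<Longrightarrow> sum_list ds \<le> sum_list es"
    using assms unfolding is_representation_def by blast
  then have "greedy ds" by (intro greedy_if_minimal) auto
  with j show ?thesis
    using greedy_nth_wd(1)[of ds j] lim_word_eq_wd[of n j] by simp
qed

lemma is_representation_exists:
  assumes "0 < n"
  shows "\<exists>ds. is_representation wlen n ds"
proof -
  define k where "k = (LEAST k. n < wlen k)"
  have k: "n < wlen k" unfolding k_def by (rule LeastI[of _ n]) (rule less_wlen)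
  then obtain j where j: "k = Suc j" using assms by (cases k) auto
  have "wlen j \<le> n"
    using not_less_Least[of j "\<lambda>k. n < wlen k"] j unfolding k_def by auto
  define P where "P es \<longleftrightarrow> length es = Suc j \<and> digit_value wlen es = n" for es
  have "digit_value wlen (replicate j 0 @ [n]) = n" by (induction j) auto
  then have "P (replicate j 0 @ [n])" by (simp add: P_def)
  then obtain ds where "P ds" "\<And>es. P es \<Longrightarrow> sum_list ds \<le> sum_list es"
    using ex_has_least_nat[of P _ sum_list] by blast
  then show ?thesis
    using k j \<open>wlen j \<le> n\<close> unfolding is_representation_def P_def by blast
qed

text \<open>Trades digit strings for letters, the form in which the game arguments use the set. At 0
  both sides fail because the first letter is 0.\<close>

lemma I_set_eq: "I_set = insert 1 {n. lim_word n = 2}"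
proof (intro set_eqI)
  fix n
  show "n \<in> I_set \<longleftrightarrow> n \<in> insert 1 {n. lim_word n = 2}"
  proof (cases "n = 0")
    case False
    then show ?thesis
      using is_representation_exists[of n] lim_word_eq_2_iff_ends_in_two_block[of n]
      unfolding I_set_def by auto
  qed (simp add: I_set_def)
qed

section \<open>Sprague-Grundy values of the truncated and the full sets\<close>

text \<open>The two conditions make \<open>f n\<close> the mex of its option values, and the
  defining recursion has only one solution.\<close>

lemma SG_eqI:
  assumes "\<And>n s. s \<in> S \<Longrightarrow> 0 < s \<Longrightarrow> s \<le> n \<Longrightarrow> f (n - s) \<noteq> f n"
    and "\<And>n v. v < f n \<Longrightarrow> \<exists>s\<in>S. 0 < s \<and> s \<le> n \<and> f (n - s) = v"
  shows "SG S = f"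
proof
  fix n
  show "SG S n = f n"
  proof (induction n rule: less_induct)
    case (less n)
    have "(\<lambda>s. SG S (n - s)) ` {s \<in> S. 0 < s \<and> s \<le> n}
        = (\<lambda>s. f (n - s)) ` {s \<in> S. 0 < s \<and> s \<le> n}"
      by (intro image_cong) (auto simp: less)
    then have "SG S n = (LEAST v. v \<notin> (\<lambda>s. f (n - s)) ` {s \<in> S. 0 < s \<and> s \<le> n})"
      by (subst SG.simps) (simp add: mex_def)
    also have "\<dots> = f n"
    proof (rule Least_equality)
      show "f n \<notin> (\<lambda>s. f (n - s)) ` {s \<in> S. 0 < s \<and> s \<le> n}"
        using assms(1) by fastforce
      show "f n \<le> v" if "v \<notin> (\<lambda>s. f (n - s)) ` {s \<in> S. 0 < s \<and> s \<le> n}" for v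
        using assms(2)[of v n] that by (force simp: not_less[symmetric])
    qed
    finally show ?case .
  qed
qed

lemma SG_restrict: "n < b \<Longrightarrow> SG {s \<in> S. s < b} n = SG S n"
proof (induction n rule: less_induct)
  case (less n)
  have "(\<lambda>s. SG {s \<in> S. s < b} (n - s)) ` {s \<in> {s \<in> S. s < b}. 0 < s \<and> s \<le> n}
      = (\<lambda>s. SG S (n - s)) ` {s \<in> S. 0 < s \<and> s \<le> n}"
    using less by (intro image_cong) auto
  then show ?case
    by (simp only: SG.simps[of _ n])
qed

text \<open>Such a rotation moves a residue up by \<open>t\<close> or, past \<open>q\<close>, down
  by \<open>q - t\<close>, in both cases by at least \<open>p\<close>. Residues in the same interval
  differ by less than \<open>p\<close>.\<close>

lemma rot_code_shift_neq:
  assumes "0 < p" "2 * p \<le> q" "q \<le> 3 * p" "s * p = l * q + t" "p \<le> t" "t \<le> q - p"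
  shows "rot_code p q (n + s) \<noteq> rot_code p q n"
proof -
  from assms have "q > 0" by simp
  then obtain k y where y: "(n + 1) * p = k * q + y" "1 \<le> y" "y \<le> q"
    and code: "rot_code p q n = (if y \<le> p then 0 else if y \<le> 2 * p then 1 else 2)"
    by (rule rot_code_cases)
  show ?thesis
  proof (cases "y + t \<le> q")
    case True
    have "rot_code p q (n + s) = (if y + t \<le> p then 0 else if y + t \<le> 2 * p then 1 else 2)"
      by (rule rot_code_eqI[where k = "k + l"]) (use y True assms in \<open>auto simp: algebra_simps\<close>)
    then show ?thesis unfolding code using True y assms by auto
  next
    case False
    have "rot_code p q (n + s) =
        (if y + t - q \<le> p then 0 else if y + t - q \<le> 2 * p then 1 else 2)"
      by (rule rot_code_eqI[where k = "k + l + 1"])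
        (use y False assms in \<open>auto simp: algebra_simps\<close>)
    then show ?thesis unfolding code using False y assms by auto
  qed
qed

text \<open>The option 1 rotates by \<open>p\<close>. A letter 2 at \<open>s\<close> puts
  \<open>(s + 1) * p\<close> into \<open>(2 * p, q]\<close>, so \<open>s\<close> rotates by an
  amount in \<open>(p, q - p]\<close>.\<close>

lemma rot_code_option_neq:
  assumes "0 < p" "2 * p \<le> q" "q \<le> 3 * p" "s = 1 \<or> rot_code p q s = 2"
  shows "rot_code p q (n + s) \<noteq> rot_code p q n"
  using assms(4)
proof
  assume "s = 1"
  then show ?thesis
    using assms by (intro rot_code_shift_neq[where l = 0 and t = p]) auto
next
  assume "rot_code p q s = 2"
  moreover from assms have "q > 0" by simp
  then obtain k y where "(s + 1) * p = k * q + y" "1 \<le> y" "y \<le> q"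
    "rot_code p q s = (if y \<le> p then 0 else if y \<le> 2 * p then 1 else 2)"
    by (rule rot_code_cases)
  ultimately show ?thesis
    using assms by (intro rot_code_shift_neq[where l = k and t = "y - p"])
      (auto simp: algebra_simps split: if_splits)
qed

text \<open>One step back lowers the residue by \<open>p\<close>, which leads into the interval just
  below because \<open>q - 2 * p \<le> p\<close>.\<close>

lemma rot_code_pred:
  assumes "0 < p" "2 * p \<le> q" "q \<le> 3 * p" "rot_code p q n \<noteq> 0"
  shows "rot_code p q (n - 1) = rot_code p q n - 1"
proof -
  from assms have "q > 0" by simp
  then obtain k y where y: "(n + 1) * p = k * q + y" "1 \<le> y" "y \<le> q"
    and code: "rot_code p q n = (if y \<le> p then 0 else if y \<le> 2 * p then 1 else 2)"
    by (rule rot_code_cases)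
  have "rot_code p q (n - 1) = (if y - p \<le> p then 0 else if y - p \<le> 2 * p then 1 else 2)"
    by (rule rot_code_eqI[where k = k])
      (use y code assms in \<open>auto simp: algebra_simps split: if_splits\<close>)
  then show ?thesis
    using assms code y by (auto split: if_splits)
qed

text \<open>\<open>Suc n - wlen (Suc k)\<close> is \<open>n\<close> minus the element
  \<open>wlen (Suc k) - 1\<close> of \<open>T_set\<close>. As a property of lists this survives
  concatenation, since the move stays within one factor.\<close>

definition twos_reach_zero :: "nat list \<Rightarrow> bool" where
  "twos_reach_zero u \<longleftrightarrow> (\<forall>n<length u. u ! n = 2 \<longrightarrow>
     (\<exists>k. wlen (Suc k) \<le> Suc n \<and> u ! (Suc n - wlen (Suc k)) = 0))"

lemma twos_reach_zero_append:
  assumes "twos_reach_zero u" "twos_reach_zero v"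
  shows "twos_reach_zero (u @ v)"
  unfolding twos_reach_zero_def
proof (intro allI impI)
  fix n assume n: "n < length (u @ v)" "(u @ v) ! n = 2"
  show "\<exists>k. wlen (Suc k) \<le> Suc n \<and> (u @ v) ! (Suc n - wlen (Suc k)) = 0"
  proof (cases "n < length u")
    case True
    then obtain k where k: "wlen (Suc k) \<le> Suc n" "u ! (Suc n - wlen (Suc k)) = 0"
      using assms(1) n unfolding twos_reach_zero_def by (auto simp: nth_append)
    moreover have "Suc n - wlen (Suc k) < length u"
      using True wlen_pos[of "Suc k"] by linarith
    ultimately show ?thesis by (auto simp: nth_append)
  next
    case False
    define m where "m = n - length u"
    have m: "n = length u + m" using False by (simp add: m_def)
    then obtain k where k: "wlen (Suc k) \<le> Suc m" "v ! (Suc m - wlen (Suc k)) = 0"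
      using assms(2) n unfolding twos_reach_zero_def by (auto simp: nth_append)
    moreover have "Suc n - wlen (Suc k) = length u + (Suc m - wlen (Suc k))"
      using k m by simp
    ultimately show ?thesis
      using m by (intro exI[of _ k]) (simp only: nth_append_length_plus, simp)
  qed
qed

text \<open>The added 2 completes a list of length \<open>wlen (Suc k)\<close>, so its move leads to
  the first letter.\<close>

lemma twos_reach_zero_snoc:
  assumes "twos_reach_zero u" "Suc (length u) = wlen (Suc k)" "u \<noteq> []" "u ! 0 = 0"
  shows "twos_reach_zero (u @ [2])"
  unfolding twos_reach_zero_def
proof (intro allI impI)
  fix n assume n: "n < length (u @ [2])" "(u @ [2]) ! n = 2"
  show "\<exists>k. wlen (Suc k) \<le> Suc n \<and> (u @ [2]) ! (Suc n - wlen (Suc k)) = 0"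
  proof (cases "n < length u")
    case True
    then obtain k where k: "wlen (Suc k) \<le> Suc n" "u ! (Suc n - wlen (Suc k)) = 0"
      using assms(1) n unfolding twos_reach_zero_def by (auto simp: nth_append)
    moreover have "Suc n - wlen (Suc k) < length u"
      using True wlen_pos[of "Suc k"] by linarith
    ultimately show ?thesis by (auto simp: nth_append)
  next
    case False
    then show ?thesis using n assms by (intro exI[of _ k]) (auto simp: nth_append)
  qed
qed

lemma butlast_wd_tail: "wd_tail n = butlast (wd_tail n) @ [2]"
  by (induction n) (auto simp: butlast_append wd_tail_nonempty)

text \<open>For \<open>i > 0\<close>, dropping the last letter leaves a product of shorter words,
  and the final 2 reaches the initial 0 of the whole word.\<close>

lemma twos_reach_zero_wd: "twos_reach_zero (wd (Suc i))"
proof (induction i rule: less_induct)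
  case (less i)
  show ?case
  proof (cases i)
    case 0
    then show ?thesis by (auto simp: twos_reach_zero_def less_Suc_eq)
  next
    case (Suc n)
    have "twos_reach_zero (butlast (wd_tail m))" if "m \<le> n" for m
      using that
    proof (induction m)
      case 0
      then show ?case by (simp add: twos_reach_zero_def)
    next
      case (Suc m)
      then show ?case
        using less[of m] \<open>i = Suc n\<close>
        by (auto simp: butlast_append wd_tail_nonempty intro: twos_reach_zero_append)
    qed
    then have opt: "twos_reach_zero (wd (Suc n) @ wd (Suc n) @ butlast (wd_tail n))"
        (is "twos_reach_zero ?u")
      using less[of n] Suc by (auto intro: twos_reach_zero_append)
    have wd: "wd (Suc i) = ?u @ [2]"
      unfolding Suc wd_Suc_Suc using butlast_wd_tail[of n] by simp
    have "wd (Suc n) ! 0 = 0" using lim_word_eq_wd[of 0 n] by simp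
    moreover have "wd (Suc n) \<noteq> []"
      using length_wd[of n] wlen_pos[of "Suc n"] by (metis length_0_conv less_irrefl)
    ultimately show ?thesis
      unfolding wd using length_wd[of i, unfolded wd] opt
      by (intro twos_reach_zero_snoc[where k = i]) (auto simp: nth_append)
  qed
qed

lemma lim_word_zero_option:
  assumes "lim_word n = 2"
  obtains t where "t \<in> T_set" "0 < t" "t \<le> n" "lim_word (n - t) = 0"
proof -
  have n: "n < wlen (Suc n)" using less_wlen[of "Suc n"] by simp
  then have "wd (Suc n) ! n = 2" using assms lim_word_eq_wd by simp
  then obtain k where k: "wlen (Suc k) \<le> Suc n" "wd (Suc n) ! (Suc n - wlen (Suc k)) = 0"
    using n twos_reach_zero_wd[of n] unfolding twos_reach_zero_def by auto
  have k1: "1 < wlen (Suc k)" using wlen_less_Suc[of k] wlen_pos[of k] by linarith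
  show ?thesis
  proof (rule that[of "wlen (Suc k) - 1"])
    show "wlen (Suc k) - 1 \<in> T_set" unfolding T_set_def by auto
    have "n - (wlen (Suc k) - 1) = Suc n - wlen (Suc k)" using k k1 by linarith
    then show "lim_word (n - (wlen (Suc k) - 1)) = 0"
      using k n lim_word_eq_wd[of "Suc n - wlen (Suc k)" n] k1 by simp
  qed (use k k1 in auto)
qed

lemma wlen_bounds: "2 * int (wlen i) \<le> int (wlen (Suc i))" "int (wlen (Suc i)) \<le> 3 * int (wlen i)"
proof -
  have "2 * wlen i \<le> wlen (Suc i) \<and> wlen (Suc i) \<le> 3 * wlen i"
  proof (cases i)
    case (Suc j)
    then show ?thesis using wlen_rec[of j] wlen_less_Suc[of j] by simp
  qed simp
  then show "2 * int (wlen i) \<le> int (wlen (Suc i))" "int (wlen (Suc i)) \<le> 3 * int (wlen i)"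
    by auto
qed

lemma lim_word_eq_rot_code:
  "n < wlen (Suc i) \<Longrightarrow> lim_word n = rot_code (wlen i) (wlen (Suc i)) n"
  using lim_word_eq_wd wd_eq_rot_code by simp

lemma omega_power_factor: "0 < b \<Longrightarrow> omega_power (factor x 0 b) n = x (n mod b)"
  by (simp add: omega_power_def factor_def)

lemma one_in_T_set: "1 \<in> T_set"
  unfolding T_set_def by (auto intro!: exI[of _ 1])

text \<open>\<open>rot_code p q\<close> depends only on \<open>n\<close> modulo \<open>q\<close>, so
  it describes the periodic word at all positions and the option lemmas for rotations apply across
  period boundaries.\<close>

lemma SG_truncated:
  assumes "T_set \<subseteq> S" "S \<subseteq> I_set"
  shows "SG {s \<in> S. s < wlen i} = omega_power (factor lim_word 0 (wlen i))"
proof (cases i)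
  case 0
  \<comment> \<open>No positive number is below \<open>wlen 0 = 1\<close>, so both sides are
    constantly 0.\<close>
  show ?thesis
    by (rule SG_eqI) (auto simp: 0 omega_power_factor)
next
  case (Suc j)
  define p q where "p = int (wlen j)" and "q = int (wlen (Suc j))"
  have pq: "0 < p" "2 * p \<le> q" "q \<le> 3 * p"
    using wlen_bounds[of j] by (auto simp: p_def q_def)
  have f: "omega_power (factor lim_word 0 (wlen i)) n = lim_word (n mod wlen i)" for n
    by (simp add: omega_power_factor)
  have code: "lim_word (n mod wlen i) = rot_code p q (int n)" for n
    using lim_word_eq_rot_code[of "n mod wlen i" j] rot_code_mod[of p q "int n"]
    by (simp add: Suc p_def q_def zmod_int)
  show ?thesis
  proof (rule SG_eqI, unfold f)
    fix n s assume s: "s \<in> {s \<in> S. s < wlen i}" "0 < s" "s \<le> n"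
    then have "s = 1 \<or> lim_word s = 2" using assms(2) I_set_eq by auto
    then have "int s = 1 \<or> rot_code p q (int s) = 2" using code[of s] s by auto
    from rot_code_option_neq[OF pq this, of "int n - int s"]
    show "lim_word ((n - s) mod wlen i) \<noteq> lim_word (n mod wlen i)"
      using s unfolding code by (simp add: of_nat_diff)
  next
    fix n v assume v: "v < lim_word (n mod wlen i)"
    have "lim_word (n mod wlen i) \<le> 2" unfolding code rot_code_def by (simp add: Let_def)
    then consider "v = lim_word (n mod wlen i) - 1" | "lim_word (n mod wlen i) = 2" "v = 0"
      using v by linarith
    then show "\<exists>s\<in>{s \<in> S. s < wlen i}. 0 < s \<and> s \<le> n \<and> lim_word ((n - s) mod wlen i) = v"
    proof cases
      case 1
      have "n \<noteq> 0" using v by (cases n) auto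
      moreover have "rot_code p q (int n - 1) = v"
        using rot_code_pred[OF pq, of "int n"] v 1 unfolding code by simp
      ultimately have "lim_word ((n - 1) mod wlen i) = v"
        unfolding code by (simp add: of_nat_diff)
      moreover have "1 < wlen i" using wlen_less_Suc[of j] wlen_pos[of j] unfolding Suc by linarith
      ultimately show ?thesis
        using one_in_T_set assms(1) \<open>n \<noteq> 0\<close> by (intro bexI[of _ 1]) auto
    next
      case 2
      \<comment> \<open>The move is at most \<open>n mod wlen i\<close>, so it crosses no multiple
        of \<open>wlen i\<close> and belongs to the truncated set.\<close>
      from 2(1) obtain t where t: "t \<in> T_set" "0 < t" "t \<le> n mod wlen i"
        "lim_word (n mod wlen i - t) = 0"
        by (rule lim_word_zero_option)
      have less: "n mod wlen i < wlen i" by simp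
      have "n - t = (n mod wlen i - t) + wlen i * (n div wlen i)"
        using t(3) mult_div_mod_eq[of "wlen i" n] by linarith
      then have "(n - t) mod wlen i = n mod wlen i - t"
        using less by (simp del: mult_div_mod_eq mod_less_divisor)
      then show ?thesis
        using t assms(1) 2 less mod_less_eq_dividend[of n "wlen i"]
        by (intro bexI[of _ t]) (auto intro: le_trans le_less_trans simp del: mod_less_divisor)
    qed
  qed
qed

text \<open>Truncation at \<open>wlen n > n\<close> is invisible at position \<open>n\<close>, both
  for the game and for the periodic word.\<close>

lemma SG_eq_lim_word:
  assumes "T_set \<subseteq> S" "S \<subseteq> I_set"
  shows "SG S = lim_word"
proof
  fix n
  show "SG S n = lim_word n"
    using SG_restrict[OF less_wlen, of S n] SG_truncated[OF assms, of n] less_wlen[of n]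
    by (simp add: omega_power_factor)
qed

lemma lim_word_wlen_minus_1: "lim_word (wlen (Suc (Suc i)) - 1) = 2"
proof -
  have "wd (Suc (Suc i)) = (wd (Suc i) @ wd (Suc i) @ butlast (wd_tail i)) @ [2]"
    unfolding wd_Suc_Suc using butlast_wd_tail[of i] by simp
  then have "last (wd (Suc (Suc i))) = 2" "wd (Suc (Suc i)) \<noteq> []" by auto
  then show ?thesis
    using lim_word_eq_wd[of "wlen (Suc (Suc i)) - 1" "Suc i"] by (simp add: last_conv_nth)
qed

text \<open>Every word from the second on ends in the letter 2. The first ends in 1, and its element
  \<open>wlen 1 - 1 = 1\<close> is in \<open>I_set\<close> by definition.\<close>

lemma T_set_subset_I_set: "T_set \<subseteq> I_set"
proof
  fix t assume "t \<in> T_set"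
  then obtain i where t: "t = wlen (Suc i) - 1"
    unfolding T_set_def by (auto simp: Suc_le_eq gr0_conv_Suc)
  show "t \<in> I_set"
    by (cases i) (use t lim_word_wlen_minus_1 in \<open>auto simp: I_set_eq\<close>)
qed


section \<open>Frequency of the letter 2: density and aperiodicity\<close>

definition count_two :: "nat \<Rightarrow> nat" where
  "count_two n = card {k. k < n \<and> lim_word k = 2}"

lemma count_two_0 [simp]: "count_two 0 = 0"
  by (simp add: count_two_def)

lemma count_two_Suc: "count_two (Suc n) = count_two n + of_bool (lim_word n = 2)"
proof -
  have "{k. k < Suc n \<and> lim_word k = 2} =
      (if lim_word n = 2 then insert n else id) {k. k < n \<and> lim_word k = 2}"
    by (auto simp: less_Suc_eq)
  then show ?thesis
    unfolding count_two_def by auto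
qed

text \<open>The residue is at least \<open>2 * p\<close> exactly when lowering \<open>x\<close> by
  \<open>2 * p\<close>, that is going two positions back, leaves the quotient by \<open>q\<close>
  unchanged. Otherwise the quotient drops by 1.\<close>

lemma rot_code_eq_2_telescope:
  assumes "0 < p" "2 * p \<le> q"
  shows "of_bool (rot_code p q n = 2) = 1 - ((n + 1) * p - 1) div q + ((n - 1) * p - 1) div q"
proof -
  define x z where "x = (n + 1) * p - 1" and "z = x mod q"
  have z: "0 \<le> z" "z < q" using assms by (auto simp: z_def)
  have x: "x = q * (x div q) + z" by (simp add: z_def)
  have shift: "(n - 1) * p - 1 = x - 2 * p" by (simp add: x_def algebra_simps)
  have code: "rot_code p q n = 2 \<longleftrightarrow> 2 * p \<le> z"
    using assms by (simp add: rot_code_def x_def z_def Let_def)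
  show ?thesis
  proof (cases "2 * p \<le> z")
    case True
    have "(x - 2 * p) div q = x div q"
      by (rule int_div_pos_eq[where r = "z - 2 * p"]) (use True x z assms in auto)
    then show ?thesis using True code unfolding shift by (simp add: x_def)
  next
    case False
    have "(x - 2 * p) div q = x div q - 1"
      by (rule int_div_pos_eq[where r = "z - 2 * p + q"])
        (use False x z assms in \<open>auto simp: algebra_simps\<close>)
    then show ?thesis using False code unfolding shift by (simp add: x_def)
  qed
qed

text \<open>The sum telescopes in steps of two. At the lower end the quotients for positions 0 and
  -1 are both -1, which gives the constant -2.\<close>

lemma count_two_eq:
  fixes p q :: int
  assumes "p = wlen i" "q = wlen (Suc i)" "n \<le> wlen (Suc i)"
  shows "int (count_two n) = int n - 2 - (int n * p - 1) div q - ((int n - 1) * p - 1) div q"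
  using assms(3)
proof (induction n)
  case 0
  have "0 < p" "2 * p \<le> q" using assms wlen_bounds[of i] by auto
  then have "(- 1) div q = - 1" "(- p - 1) div q = - 1"
    by (auto intro: int_div_pos_eq[where r = "q - 1"] int_div_pos_eq[where r = "q - p - 1"])
  then show ?case by simp
next
  case (Suc n)
  have "0 < p" "2 * p \<le> q" using assms wlen_bounds[of i] by auto
  note tele = rot_code_eq_2_telescope[OF this, of "int n"]
  have "rot_code p q n = lim_word n"
    using Suc.prems lim_word_eq_rot_code[of n i] assms by simp
  then show ?case
    using Suc tele by (simp add: count_two_Suc add.commute)
qed

text \<open>The smaller root of \<open>x\<^sup>2 = 3 * x - 1\<close>, which belongs to the length
  recurrence, and the limit of \<open>wlen i / wlen (Suc i)\<close>. The frequency
  \<open>1 - 2 * rotation_angle\<close> is \<open>sqrt 5 - 2\<close>.\<close>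

definition rotation_angle :: real where "rotation_angle = (3 - sqrt 5) / 2"

lemma rotation_angle_bounds: "0 < rotation_angle" "2 * rotation_angle < 1" "rotation_angle < 1"
proof -
  have "2 < sqrt 5" "sqrt 5 < 3"
    by (auto intro: real_less_rsqrt real_less_lsqrt)
  then show "0 < rotation_angle" "2 * rotation_angle < 1" "rotation_angle < 1"
    by (auto simp: rotation_angle_def)
qed

text \<open>The left side satisfies the length recurrence with no component along the larger root,
  so each step multiplies it by the smaller one.\<close>

lemma wlen_rotation_angle:
  "wlen (Suc i) * rotation_angle - wlen i = (2 * rotation_angle - 1) * rotation_angle ^ i"
proof (induction i)
  case (Suc i)
  have sq: "rotation_angle * rotation_angle = 3 * rotation_angle - 1"
    by (simp add: rotation_angle_def field_simps)
  have rec: "real (wlen (Suc (Suc i))) = 3 * real (wlen (Suc i)) - real (wlen i)"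
    using arg_cong[OF wlen_rec[of i], of real] by simp
  have "wlen (Suc (Suc i)) * rotation_angle - wlen (Suc i)
      = wlen (Suc i) * (3 * rotation_angle - 1) - wlen i * rotation_angle"
    unfolding rec by (simp add: algebra_simps)
  also have "\<dots> = (wlen (Suc i) * rotation_angle - wlen i) * rotation_angle"
    unfolding sq[symmetric] by (simp add: algebra_simps)
  also have "\<dots> = (2 * rotation_angle - 1) * rotation_angle ^ Suc i"
    unfolding Suc by simp
  finally show ?case .
qed simp

lemma wlen_rotation_angle_bound: "\<bar>wlen (Suc i) * rotation_angle - wlen i\<bar> \<le> 1"
proof -
  have "\<bar>(2 * rotation_angle - 1) * rotation_angle ^ i\<bar> \<le> 1 * 1"
    unfolding abs_mult using rotation_angle_bounds by (intro mult_mono) (auto simp: power_le_one)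
  then show ?thesis unfolding wlen_rotation_angle by simp
qed

text \<open>Replacing \<open>P / Q\<close> by its limit costs at most 2, since
  \<open>n \<le> Q\<close> and \<open>Q * rotation_angle\<close> is within 1 of \<open>P\<close>.
  The rounding of the two quotients and the boundary terms cost at most 2 more.\<close>

lemma count_two_bound: "\<bar>count_two n - n * (1 - 2 * rotation_angle)\<bar> \<le> 4"
proof -
  define p q where "p = int (wlen n)" and "q = int (wlen (Suc n))"
  define P Q where "P = real_of_int p" and "Q = real_of_int q"
  have n: "n \<le> wlen (Suc n)" using less_wlen[of "Suc n"] by simp
  have pq: "0 < P" "2 * P \<le> Q"
    using wlen_bounds(1)[of n] unfolding P_def Q_def p_def q_def by (simp, linarith)
  define A B where "A = real_of_int ((int n * p - 1) div q)"
    and "B = real_of_int (((int n - 1) * p - 1) div q)"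
  have A: "A \<le> (n * P - 1) / Q" "(n * P - 1) / Q - A \<le> 1"
    using real_of_int_div4[of "int n * p - 1" q] real_of_int_div3[of "int n * p - 1" q]
    by (simp_all add: A_def P_def Q_def)
  have B: "B \<le> ((real n - 1) * P - 1) / Q" "((real n - 1) * P - 1) / Q - B \<le> 1"
    using real_of_int_div4[of "(int n - 1) * p - 1" q] real_of_int_div3[of "(int n - 1) * p - 1" q]
    by (simp_all add: B_def P_def Q_def)
  have "real (count_two n) = real n - 2 - A - B"
    using arg_cong[OF count_two_eq[OF p_def q_def n], of real_of_int] by (simp add: A_def B_def)
  moreover have "(n * P - 1) / Q + ((real n - 1) * P - 1) / Q = 2 * (n * P / Q) - (2 + P) / Q"
    using pq by (simp add: field_simps)
  moreover have "0 \<le> (2 + P) / Q" using pq by simp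
  moreover have "(2 + P) / Q \<le> 2"
  proof -
    have "1 \<le> P" unfolding P_def p_def using wlen_pos[of n] by linarith
    then have "2 + P \<le> 2 * Q" using pq by linarith
    then show ?thesis using pq by (simp add: divide_le_eq)
  qed
  moreover have "\<bar>n * P / Q - n * rotation_angle\<bar> \<le> 1"
  proof -
    have "n * P / Q - n * rotation_angle = - (n / Q) * (Q * rotation_angle - P)"
      using pq by (simp add: field_simps)
    moreover have "\<bar>(n / Q) * (Q * rotation_angle - P)\<bar> \<le> 1 * 1"
      unfolding abs_mult
    proof (intro mult_mono)
      show "\<bar>n / Q\<bar> \<le> 1" using n pq by (simp add: Q_def q_def)
      show "\<bar>Q * rotation_angle - P\<bar> \<le> 1"
        using wlen_rotation_angle_bound[of n] by (simp add: P_def Q_def p_def q_def)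
    qed auto
    ultimately show ?thesis by simp
  qed
  ultimately show ?thesis
    using A B unfolding right_diff_distrib by linarith
qed

lemma card_I_set: "0 < n \<Longrightarrow> card (I_set \<inter> {1..n}) = Suc (count_two (Suc n))"
proof -
  assume "0 < n"
  have "k \<noteq> 0" if "lim_word k = 2" for k using that by (cases k) auto
  then have "I_set \<inter> {1..n} = insert 1 {k. k < Suc n \<and> lim_word k = 2}"
    using \<open>0 < n\<close> by (force simp: I_set_eq Suc_le_eq less_Suc_eq_le)
  then show ?thesis by (simp add: count_two_def)
qed

lemma density_I_set: "has_natural_density I_set (1 - 2 * rotation_angle)"
  unfolding has_natural_density_def
proof (rule tendsto_sandwich)
  let ?d = "1 - 2 * rotation_angle"
  \<comment> \<open>4 comes from the letter count, 1 from the extra element 1 of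
    \<open>I_set\<close>, and \<open>?d < 1\<close> from passing from \<open>n + 1\<close> to
    \<open>n\<close>.\<close>
  have bound: "\<bar>card (I_set \<inter> {1..n}) - n * ?d\<bar> \<le> 6" if "0 < n" for n :: nat
  proof -
    have "\<bar>count_two (Suc n) - (n + 1) * ?d\<bar> \<le> 4"
      using count_two_bound[of "Suc n"] by (simp add: add.commute)
    moreover have "real (card (I_set \<inter> {1..n})) = count_two (Suc n) + 1"
      using card_I_set[OF that] by simp
    moreover have "(n + 1) * ?d = n * ?d + ?d" by (simp add: algebra_simps)
    ultimately show ?thesis using rotation_angle_bounds by linarith
  qed
  show "\<forall>\<^sub>F n in sequentially. ?d - 6 / real n \<le> real (card (I_set \<inter> {1..n})) / real n"
    using eventually_gt_at_top[of 0]
  proof eventually_elim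
    case (elim n)
    have "(n * ?d - 6) / n \<le> real (card (I_set \<inter> {1..n})) / n"
      using bound[OF elim] by (intro divide_right_mono) linarith+
    then show ?case using elim by (simp add: diff_divide_distrib)
  qed
  show "\<forall>\<^sub>F n in sequentially. real (card (I_set \<inter> {1..n})) / real n \<le> ?d + 6 / real n"
    using eventually_gt_at_top[of 0]
  proof eventually_elim
    case (elim n)
    have "real (card (I_set \<inter> {1..n})) / n \<le> (n * ?d + 6) / n"
      using bound[OF elim] by (intro divide_right_mono) linarith+
    then show ?case using elim by (simp add: add_divide_distrib)
  qed
  show "(\<lambda>n. ?d - 6 / real n) \<longlonglongrightarrow> ?d" "(\<lambda>n. ?d + 6 / real n) \<longlonglongrightarrow> ?d"
    by (auto intro!: tendsto_eq_intros lim_const_over_n)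
qed

text \<open>Descent \<open>(m, p) \<mapsto> (p - 4m, m)\<close>; this is the irrationality of \<open>\<surd>5\<close>.\<close>

lemma quadratic_no_positive_solution:
  fixes m p :: nat
  assumes "m * m + 4 * m * p = p * p"
  shows "p = 0"
  using assms
proof (induction p arbitrary: m rule: less_induct)
  case (less p)
  show ?case
  proof (cases "m = 0")
    case True
    then show ?thesis using less.prems by simp
  next
    case False
    have "4 * m < p"
    proof (rule ccontr)
      assume "\<not> 4 * m < p"
      then have "p * p \<le> 4 * m * p" by (intro mult_right_mono) auto
      moreover have "0 < m * m" using False by simp
      ultimately show False using less.prems by linarith
    qed
    then obtain r where r: "p = 4 * m + r" using less_imp_add_positive by blast
    have "r * r + 4 * r * m = m * m"
      using less.prems unfolding r by (simp add: algebra_simps)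
    then show ?thesis using less.IH[of m r] \<open>4 * m < p\<close> False by simp
  qed
qed

text \<open>If every period of length \<open>p\<close> holds \<open>m\<close> letters 2, the bounded
  discrepancy forces \<open>m / p\<close> to equal the irrational frequency
  \<open>sqrt 5 - 2\<close>.\<close>

lemma lim_word_aperiodic: "\<not> eventually_periodic lim_word"
proof
  assume "eventually_periodic lim_word"
  then obtain p N where p: "p > 0" and per: "\<And>n. n \<ge> N \<Longrightarrow> lim_word (n + p) = lim_word n"
    unfolding eventually_periodic_def by blast
  let ?d = "1 - 2 * rotation_angle"
  define m where "m = count_two (N + p) - count_two N"
  have mono: "count_two N \<le> count_two (N + p)"
    unfolding count_two_def by (intro card_mono) auto
  have step: "count_two (N + j + p) = count_two (N + j) + m" for j
  proof (induction j)
    case (Suc j)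
    then show ?case using per[of "N + j"] by (simp add: count_two_Suc)
  qed (use mono in \<open>simp add: m_def\<close>)
  have count: "count_two (N + k * p) = count_two N + k * m" for k
  proof (induction k)
    case (Suc k)
    then show ?case using step[of "k * p"] by (simp add: algebra_simps)
  qed simp
  \<comment> \<open>Over \<open>k\<close> periods the discrepancy changes by
    \<open>k * (m - p * ?d)\<close>, while it is at most 4 at both ends.\<close>
  have bound: "real k * \<bar>m - p * ?d\<bar> \<le> 8" for k
  proof -
    have "\<bar>(count_two N + k * m) - (N + k * p) * ?d\<bar> \<le> 4"
      using count_two_bound[of "N + k * p"] unfolding count by simp
    moreover have "(count_two N + k * m) - (N + k * p) * ?d
        = (count_two N - N * ?d) + k * (m - p * ?d)"
      by (simp add: algebra_simps)
    ultimately have "\<bar>k * (m - p * ?d)\<bar> \<le> 8"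
      using count_two_bound[of N] by linarith
    then show ?thesis by (simp add: abs_mult)
  qed
  have "m - p * ?d = 0"
  proof (rule ccontr)
    assume "m - p * ?d \<noteq> 0"
    then obtain k where "8 < real k * \<bar>m - p * ?d\<bar>"
      using reals_Archimedean3[of "\<bar>m - p * ?d\<bar>"] by auto
    then show False using bound[of k] by simp
  qed
  then have "real m + 2 * p = sqrt 5 * p"
    by (simp add: rotation_angle_def field_simps)
  then have "(real m + 2 * p)\<^sup>2 = 5 * (real p)\<^sup>2"
    by (simp add: power_mult_distrib)
  then have "real (m * m + 4 * m * p) = real (p * p)"
    by (simp add: power2_eq_square algebra_simps)
  then have "m * m + 4 * m * p = p * p" by (simp only: of_nat_eq_iff)
  then show False using quadratic_no_positive_solution p by blast
qed

theorem theorem5p19: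
  shows "(\<forall>S. T_set \<subseteq> S \<and> S \<subseteq> I_set \<longrightarrow> SG S = lim_word)
    \<and> (\<forall>S. T_set \<subseteq> S \<and> S \<subseteq> I_set \<longrightarrow>
          (\<forall>i. SG {s \<in> S. s < wlen i} = omega_power (factor lim_word 0 (wlen i))))
    \<and> (0 \<notin> I_set \<and> (\<exists>d>0. has_natural_density I_set d) \<and>
         range (SG I_set) \<subseteq> {0, 1, 2} \<and> \<not> eventually_periodic (SG I_set))"
proof -
  have "SG I_set = lim_word"
    using SG_eq_lim_word T_set_subset_I_set by blast
  moreover have "lim_word n \<in> {0, 1, 2}" for n
  proof -
    have "n < wlen (Suc n)" using less_wlen[of "Suc n"] by simp
    then show ?thesis by (simp add: lim_word_eq_rot_code rot_code_def Let_def)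
  qed
  moreover have "0 < 1 - 2 * rotation_angle" using rotation_angle_bounds by simp
  then have "\<exists>d>0. has_natural_density I_set d" using density_I_set by blast
  moreover have "0 \<notin> I_set" by (simp add: I_set_eq)
  ultimately show ?thesis
    using SG_eq_lim_word SG_truncated lim_word_aperiodic by (simp add: image_subset_iff)
qed

end
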